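(* There is a universal constant $c_2>0$ such that the following holds. Fix any $\varepsilon\in(0,1)$ and $\delta\in(0,c_2\varepsilon]$, let $h\in\mathbb{N}$ be sufficiently large, and let $d:=\lceil\delta h\rceil$. Let $N$ be the largest integer satisfying $h\ge d\log_{\sqrt d}(N/d)$, and let $R_{h,N}$ be an $h\times N$ matrix with i.i.d. uniform $\pm1$ entries. Then with probability $1-o(1)$ (as $h\to\infty$), $d_2(\ker(R_{h,N}))\ge 2(1-\varepsilon)d$.
   Context: For a subspace $C\subseteq\mathbb{R}^N$, the order-2 Hamming weight $d_2(C)$ is the minimum of $|\mathrm{supp}(u_1)\cup\mathrm{supp}(u_2)|$ over all pairs of linearly independent vectors $u_1,u_2\in C$, where $\mathrm{supp}(u)$ is the set of nonzero coordinates of $u$. *)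

theory Defs
  imports Complex_Main "HOL-Library.Extended_Real"
begin

text \<open>Vectors of \<real>^N are represented as functions nat \<Rightarrow> real vanishing outside {..<N};
  h \<times> N matrices as functions nat \<Rightarrow> nat \<Rightarrow> real vanishing outside {..<h} \<times> {..<N}.\<close>

definition supp :: "(nat \<Rightarrow> real) \<Rightarrow> nat set" where
  "supp u = {j. u j \<noteq> 0}"

definition lin_indep2 :: "(nat \<Rightarrow> real) \<Rightarrow> (nat \<Rightarrow> real) \<Rightarrow> bool" where
  "lin_indep2 u v \<longleftrightarrow> (\<forall>a b :: real. (\<forall>j. a * u j + b * v j = 0) \<longrightarrow> a = 0 \<and> b = 0)"

text \<open>Order-2 Hamming weight; the minimum over an empty set is +\<infinity>.\<close>
definition d2 :: "(nat \<Rightarrow> real) set \<Rightarrow> ereal" where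
  "d2 C = Inf {ereal (real (card (supp u1 \<union> supp u2))) | u1 u2.
                 u1 \<in> C \<and> u2 \<in> C \<and> lin_indep2 u1 u2}"

definition pm_matrices :: "nat \<Rightarrow> nat \<Rightarrow> (nat \<Rightarrow> nat \<Rightarrow> real) set" where
  "pm_matrices h N = {M. (\<forall>i j. i < h \<and> j < N \<longrightarrow> M i j \<in> {-1, 1}) \<and>
                         (\<forall>i j. \<not> (i < h \<and> j < N) \<longrightarrow> M i j = 0)}"

definition matrix_kernel :: "nat \<Rightarrow> nat \<Rightarrow> (nat \<Rightarrow> nat \<Rightarrow> real) \<Rightarrow> (nat \<Rightarrow> real) set" where
  "matrix_kernel h N M = {u. (\<forall>j\<ge>N. u j = 0) \<and> (\<forall>i<h. (\<Sum>j<N. M i j * u j) = 0)}"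

definition bigN :: "nat \<Rightarrow> nat \<Rightarrow> nat" where
  "bigN h d = (GREATEST N :: nat. real h \<ge> real d * log (sqrt (real d)) (real N / real d))"

end

theory Submission
  imports Defs "HOL-Library.Multiset" "HOL-Library.FuncSet" "HOL-Real_Asymp.Real_Asymp"
begin

text \<open>
  Put \<open>T = d^(1-\<epsilon>/4)\<close>. If \<open>d2\<close> is too small, then the kernel contains either a nonzero vector of support
  smaller than \<open>T\<close>, or a pair with joint support of size at most \<open>s = 2 (1 - \<epsilon>) d\<close> all of whose nontrivial
  combinations have support at least \<open>T\<close>. A random sign row is orthogonal to a nonzero vector with
  probability at most \<open>1/2\<close>, and to such a pair with probability at most \<open>4/T\<close>: the columns of the
  \<open>2 \<times> N\<close> matrix of the pair contain about \<open>T/2\<close> disjoint linearly independent pairs, and one compares with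
  the sum of many signed copies of a single one.

  A kernel of an \<open>h \<times> s\<close> matrix is determined by \<open>s\<close> of its rows, so that the union bound over supports and
  row sets costs \<open>N^s h^s\<close> against \<open>q^(h-s)\<close>. Since \<open>N \<le> d \<cdot> d^(h/2d)\<close>, the first event has probability
  \<open>exp (O (h^(1-\<epsilon>/4) ln h) - h ln 2)\<close>; in the second, \<open>N^s\<close> contributes \<open>d^((1-\<epsilon>) h)\<close> against \<open>d^(-(1-\<epsilon>/4) h)\<close>, and
  the remaining factor \<open>d^(6d)\<close> is absorbed by \<open>\<delta> \<le> \<epsilon>/24\<close>.
\<close>

section \<open>Anticoncentration of signed sums\<close>

text \<open>The probability that \<open>\<Sum>a\<in>#A. \<plusminus>a = x\<close> for independent uniform signs.\<close>

definition sign_prob :: "'a::ab_group_add multiset \<Rightarrow> 'a \<Rightarrow> real" where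
  "sign_prob A = fold_mset (\<lambda>a f x. (f (x - a) + f (x + a)) / 2) (\<lambda>x. if x = 0 then 1 else 0) A"

lemma sign_prob_empty: "sign_prob {#} x = (if x = 0 then 1 else 0)"
  by (simp add: sign_prob_def)

text \<open>The averaging operators of two vectors commute, so the fold does not depend on an order
  and can be unfolded at any element.\<close>

lemma sign_prob_add_mset:
  "sign_prob (add_mset a A) x = (sign_prob A (x - a) + sign_prob A (x + a)) / 2"
proof -
  interpret comp_fun_commute "\<lambda>(a::'a) (f::'a \<Rightarrow> real) x. (f (x - a) + f (x + a)) / 2"
    by unfold_locales (auto simp: fun_eq_iff algebra_simps add_divide_distrib)
  show ?thesis
    by (simp add: sign_prob_def)
qed

lemma sign_prob_nonneg: "0 \<le> sign_prob A x"
  by (induction A arbitrary: x) (simp_all add: sign_prob_empty sign_prob_add_mset)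

lemma sign_prob_uminus: "sign_prob A (- x) = sign_prob A x"
proof (induction A arbitrary: x)
  case (add a A)
  have eqs: "- x - a = - (x + a)" "- x + a = - (x - a)"
    by simp_all
  show ?case
    unfolding sign_prob_add_mset eqs add.IH by (rule arg_cong[OF add.commute])
qed (simp add: sign_prob_empty)

lemma finite_sign_prob_support: "finite {x. sign_prob A x \<noteq> 0}"
proof (induction A)
  case (add a A)
  have "{x. sign_prob (add_mset a A) x \<noteq> 0}
      \<subseteq> (\<lambda>y. y + a) ` {x. sign_prob A x \<noteq> 0} \<union> (\<lambda>y. y - a) ` {x. sign_prob A x \<noteq> 0}"
  proof
    fix x assume "x \<in> {x. sign_prob (add_mset a A) x \<noteq> 0}"
    then have "sign_prob A (x - a) \<noteq> 0 \<or> sign_prob A (x + a) \<noteq> 0"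
      by (auto simp: sign_prob_add_mset)
    moreover have "x = (x - a) + a" "x = (x + a) - a"
      by simp_all
    ultimately show "x \<in> (\<lambda>y. y + a) ` {x. sign_prob A x \<noteq> 0} \<union> (\<lambda>y. y - a) ` {x. sign_prob A x \<noteq> 0}"
      by blast
  qed
  then show ?case
    using add finite_subset by blast
qed (simp add: sign_prob_empty)

text \<open>Convolution of two independent signed sums. \<open>U\<close> may be any finite superset
  of the support, so that the induction can pass to its translates by \<open>a\<close> and
  \<open>- a\<close>.\<close>

lemma sign_prob_plus:
  assumes "finite U" "{y. sign_prob A y \<noteq> 0} \<subseteq> U"
  shows "sign_prob (A + B) x = (\<Sum>y\<in>U. sign_prob A y * sign_prob B (x - y))"
  using assms
proof (induction A arbitrary: U x)
  case empty
  then have "(0::'a) \<in> U"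
    by (auto simp: sign_prob_empty)
  with empty show ?case
    by (simp add: sign_prob_empty if_distrib[of "\<lambda>c. c * _"] sum.delta cong: if_cong)
next
  case (add a A)
  have supp: "{y. sign_prob A y \<noteq> 0} \<subseteq> (\<lambda>y. y - a) ` U" "{y. sign_prob A y \<noteq> 0} \<subseteq> (\<lambda>y. y + a) ` U"
  proof -
    \<comment> \<open>Probabilities are nonnegative, so the two terms of the recursion cannot
      cancel.\<close>
    have *: "y + a \<in> U \<and> y - a \<in> U" if "sign_prob A y \<noteq> 0" for y
    proof -
      have "sign_prob A y > 0"
        using that sign_prob_nonneg[of A y] by simp
      then have "sign_prob (add_mset a A) (y + a) \<noteq> 0" "sign_prob (add_mset a A) (y - a) \<noteq> 0"
        using sign_prob_nonneg[of A "y + a + a"] sign_prob_nonneg[of A "y - a - a"]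
        by (simp_all add: sign_prob_add_mset)
      with add.prems show ?thesis
        by blast
    qed
    show "{y. sign_prob A y \<noteq> 0} \<subseteq> (\<lambda>y. y - a) ` U"
      using * by (force intro: image_eqI[where x = "y + a" for y])
    show "{y. sign_prob A y \<noteq> 0} \<subseteq> (\<lambda>y. y + a) ` U"
      using * by (force intro: image_eqI[where x = "y - a" for y])
  qed
  have minus: "sign_prob (A + B) (x - a) = (\<Sum>y\<in>U. sign_prob A (y - a) * sign_prob B (x - y))"
    using add.IH[OF _ supp(1), of "x - a"] add.prems(1)
    by (simp add: sum.reindex inj_on_def o_def)
  have plus: "sign_prob (A + B) (x + a) = (\<Sum>y\<in>U. sign_prob A (y + a) * sign_prob B (x - y))"
    using add.IH[OF _ supp(2), of "x + a"] add.prems(1)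
    by (simp add: sum.reindex inj_on_def o_def)
  show ?case
    by (simp add: sign_prob_add_mset minus plus sum.distrib sum_divide_distrib
        add_divide_distrib distrib_right)
qed

text \<open>Each product in the convolution is at most half the sum of the two squares. As the law
  is symmetric, the squares for \<open>A\<close> add up to the probability that two independent
  copies of its sum cancel.\<close>

lemma sign_prob_plus_le_average:
  "sign_prob (A + B) x \<le> (sign_prob (A + A) 0 + sign_prob (B + B) 0) / 2"
proof -
  \<comment> \<open>The reflected support of \<open>B\<close> is included so that both
    \<open>U\<close> and its reflection are admissible ranges for the convolution.\<close>
  define U where "U = {y. sign_prob A y \<noteq> 0} \<union> (\<lambda>z. x - z) ` {z. sign_prob B z \<noteq> 0}"
  have U: "finite U" "{y. sign_prob A y \<noteq> 0} \<subseteq> U"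
    by (auto simp: U_def finite_sign_prob_support)
  have V: "finite ((\<lambda>y. x - y) ` U)" "{z. sign_prob B z \<noteq> 0} \<subseteq> (\<lambda>y. x - y) ` U"
    using U(1) by (simp, force simp: U_def)
  have A: "sign_prob (A + A) 0 = (\<Sum>y\<in>U. (sign_prob A y)\<^sup>2)"
    by (simp add: sign_prob_plus[OF U] sign_prob_uminus power2_eq_square)
  have B: "sign_prob (B + B) 0 = (\<Sum>y\<in>U. (sign_prob B (x - y))\<^sup>2)"
    using sign_prob_uminus[of B "x - y" for y]
    by (simp add: sign_prob_plus[OF V] sum.reindex inj_on_def power2_eq_square)
  have "sign_prob (A + B) x = (\<Sum>y\<in>U. sign_prob A y * sign_prob B (x - y))"
    by (rule sign_prob_plus[OF U])
  also have "\<dots> \<le> (\<Sum>y\<in>U. ((sign_prob A y)\<^sup>2 + (sign_prob B (x - y))\<^sup>2) / 2)"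
  proof (rule sum_mono)
    fix y
    show "sign_prob A y * sign_prob B (x - y) \<le> ((sign_prob A y)\<^sup>2 + (sign_prob B (x - y))\<^sup>2) / 2"
      using sum_squares_bound[of "sign_prob A y" "sign_prob B (x - y)"] by simp
  qed
  also have "\<dots> = (sign_prob (A + A) 0 + sign_prob (B + B) 0) / 2"
    by (simp add: A B sum.distrib flip: sum_divide_distrib)
  finally show ?thesis .
qed

text \<open>Further independent signs only average translates of the law of \<open>A\<close>, so a
  uniform bound survives.\<close>

lemma sign_prob_plus_le:
  assumes "\<And>x. sign_prob A x \<le> b"
  shows "sign_prob (A + B) x \<le> b"
proof (induction B arbitrary: x)
  case (add a B)
  show ?case
    using add[of "x - a"] add[of "x + a"] by (simp add: sign_prob_add_mset)
qed (simp add: assms)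

text \<open>A substitute for Hoelder's inequality in Halasz's argument: splitting the blocks in halves and
  applying \<open>sign_prob_plus_le_average\<close> repeatedly trades distinct blocks for copies of a single one.\<close>

lemma sign_prob_sum_list_le:
  assumes "length Bs = 2 ^ m"
    and "\<And>B x. B \<in> set Bs \<Longrightarrow> sign_prob (repeat_mset (r * 2 ^ m) B) x \<le> b"
  shows "sign_prob (repeat_mset r (sum_list Bs)) x \<le> b"
  using assms
proof (induction m arbitrary: Bs r x)
  case 0
  then show ?case
    by (cases Bs) auto
next
  case (Suc m)
  define C D where "C = take (2 ^ m) Bs" and "D = drop (2 ^ m) Bs"
  have len: "length C = 2 ^ m" "length D = 2 ^ m" and Bs: "Bs = C @ D"
    using Suc.prems(1) by (simp_all add: C_def D_def)
  have r: "repeat_mset r A + repeat_mset r A = repeat_mset (2 * r) A" for A :: "'a multiset"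
    by (simp add: mult_2 repeat_mset_distrib)
  \<comment> \<open>Each half has half the blocks at twice the multiplicity;
    \<open>2 * r * 2 ^ m = r * 2 ^ Suc m\<close>, so the hypothesis on single blocks carries over
    unchanged.\<close>
  have C: "sign_prob (repeat_mset (2 * r) (sum_list C)) 0 \<le> b"
    using Suc.prems(2) by (intro Suc.IH len) (simp_all add: Bs mult_ac)
  have D: "sign_prob (repeat_mset (2 * r) (sum_list D)) 0 \<le> b"
    using Suc.prems(2) by (intro Suc.IH len) (simp_all add: Bs mult_ac)
  show ?case
    using sign_prob_plus_le_average[of "repeat_mset r (sum_list C)" "repeat_mset r (sum_list D)" x] C D
    by (simp add: Bs r)
qed

section \<open>Many copies of one vector or of one independent pair\<close>

lemma central_binomial_sq_upper_bound:
  "real ((2 * n) choose n) ^ 2 * (2 * real n + 1) \<le> 16 ^ n"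
proof (induction n)
  case (Suc n)
  let ?c = "real ((2 * n) choose n)" and ?c' = "real ((2 * Suc n) choose Suc n)"
  have "(2 * Suc n) choose Suc n = 2 * (Suc (2 * n) choose Suc n)"
    using binomial_symmetric[of n "Suc (2 * n)"] by simp
  moreover have "Suc n * (Suc (2 * n) choose Suc n) = Suc (2 * n) * (2 * n choose n)"
    by (metis Suc_times_binomial)
  ultimately have "Suc n * ((2 * Suc n) choose Suc n) = 2 * (Suc (2 * n) * (2 * n choose n))"
    by (metis mult.left_commute)
  then have "real (Suc n * ((2 * Suc n) choose Suc n)) = real (2 * (Suc (2 * n) * (2 * n choose n)))"
    by (rule arg_cong)
  then have rec: "(real n + 1) * ?c' = 2 * ((2 * real n + 1) * ?c)"
    by (simp only: of_nat_mult of_nat_Suc) (simp add: algebra_simps)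
  have "(real n + 1)\<^sup>2 * (?c'\<^sup>2 * (2 * real (Suc n) + 1)) = ((real n + 1) * ?c')\<^sup>2 * (2 * real n + 3)"
    by (simp add: power_mult_distrib del: mult_Suc_right)
  also have "\<dots> = 4 * (2 * real n + 1) * (2 * real n + 3) * (?c\<^sup>2 * (2 * real n + 1))"
    unfolding rec by (simp add: power_mult_distrib power2_eq_square)
  also have "\<dots> \<le> 4 * (2 * real n + 1) * (2 * real n + 3) * 16 ^ n"
    by (intro mult_left_mono Suc.IH) auto
  also have "\<dots> \<le> (16 * (real n + 1)\<^sup>2) * 16 ^ n"
    by (intro mult_right_mono) (simp_all add: power2_eq_square algebra_simps)
  finally have "(real n + 1)\<^sup>2 * (?c'\<^sup>2 * (2 * real (Suc n) + 1)) \<le> (real n + 1)\<^sup>2 * 16 ^ Suc n"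
    by simp
  then show ?case
    by (simp add: mult_le_cancel_left_pos del: mult_Suc_right)
qed simp

text \<open>With \<open>i\<close> plus signs among \<open>K\<close> the sum is
  \<open>2 * i - K\<close> times \<open>a\<close>. As \<open>a \<noteq> 0\<close>, these points are
  distinct and the law is binomial, largest in the middle.\<close>

lemma sign_prob_replicate_mset:
  fixes a :: "'a::real_vector"
  assumes "a \<noteq> 0"
  shows "sign_prob (replicate_mset K a) x \<le> real (K choose (K div 2)) / 2 ^ K"
proof -
  \<comment> \<open>The index is an integer, with value 0 below zero, so that Pascal's rule can
    refer to \<open>i - 1\<close> without a side condition.\<close>
  have val: "sign_prob (replicate_mset K a) (of_int (2 * i - int K) *\<^sub>R a)
      = (if i < 0 then 0 else real (K choose nat i) / 2 ^ K)" for i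
  proof (induction K arbitrary: i)
    case 0
    then show ?case
      using assms by (auto simp: sign_prob_empty)
  next
    case (Suc K)
    have 1: "of_int (2 * i - int (Suc K)) *\<^sub>R a - a = of_int (2 * (i - 1) - int K) *\<^sub>R a"
      by (simp add: algebra_simps scaleR_2)
    have 2: "of_int (2 * i - int (Suc K)) *\<^sub>R a + a = of_int (2 * i - int K) *\<^sub>R a"
      by (simp add: algebra_simps)
    consider "i < 0" | "i = 0" | k where "i = int (Suc k)"
      by (metis not0_implies_Suc not_less of_nat_0 zero_le_imp_eq_int)
    then show ?case
      unfolding replicate_mset_Suc sign_prob_add_mset 1 2 Suc.IH
      by cases (auto simp: nat_add_distrib add_divide_distrib)
  qed
  have out: "sign_prob (replicate_mset K a) x = 0"
    if "\<And>i::int. x \<noteq> of_int (2 * i - int K) *\<^sub>R a" for x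
    using that
  proof (induction K arbitrary: x)
    case 0
    show ?case
      using "0"[of 0] by (simp add: sign_prob_empty)
  next
    case (Suc K)
    have "x - a \<noteq> of_int (2 * i - int K) *\<^sub>R a" for i
      using Suc.prems[of "i + 1"] by (auto simp: algebra_simps)
    moreover have "x + a \<noteq> of_int (2 * i - int K) *\<^sub>R a" for i
      using Suc.prems[of i] by (auto simp: algebra_simps)
    ultimately show ?case
      by (simp add: sign_prob_add_mset Suc.IH)
  qed
  show ?thesis
  proof (cases "\<exists>i::int. x = of_int (2 * i - int K) *\<^sub>R a")
    case True
    then show ?thesis
      using val binomial_maximum[of K] by (auto intro!: divide_right_mono)
  next
    case False
    then show ?thesis
      using out[of x] by simp
  qed
qed

text \<open>The probability is of the order of the inverse square root of the number of copies;
  squaring avoids the root.\<close>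

lemma sign_prob_replicate_power2:
  fixes a :: "'a::real_vector"
  assumes "a \<noteq> 0"
  shows "(sign_prob (replicate_mset (2 ^ m) a) x)\<^sup>2 \<le> 1 / 2 ^ m"
proof -
  have "(real ((2 ^ m) choose (2 ^ m div 2)) / 2 ^ (2 ^ m))\<^sup>2 \<le> 1 / 2 ^ m"
  proof (cases m)
    case (Suc k)
    let ?n = "2 ^ k :: nat"
    have "(real ((2 * ?n) choose ?n))\<^sup>2 * (2 * real ?n) \<le> 16 ^ ?n"
      by (rule order_trans[OF mult_left_mono central_binomial_sq_upper_bound]) auto
    moreover have "(2 ^ (2 * ?n))\<^sup>2 = (16::real) ^ ?n"
      by (simp add: power_mult flip: power_mult_distrib power2_eq_square) (simp add: power2_eq_square flip: power_mult_distrib)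
    ultimately show ?thesis
      by (simp add: Suc power_divide field_simps)
  qed (simp add: power2_eq_square)
  moreover have "(sign_prob (replicate_mset (2 ^ m) a) x)\<^sup>2 \<le> (real ((2 ^ m) choose (2 ^ m div 2)) / 2 ^ (2 ^ m))\<^sup>2"
    using sign_prob_replicate_mset[OF assms] sign_prob_nonneg by (intro power_mono)
  ultimately show ?thesis
    by linarith
qed

lemma sign_prob_replicate_support:
  fixes a :: "'a::real_vector"
  assumes "sign_prob (replicate_mset K a) x \<noteq> 0"
  shows "\<exists>t. x = t *\<^sub>R a"
  using assms
proof (induction K arbitrary: x)
  case 0
  then show ?case
    by (auto simp: sign_prob_empty split: if_splits intro: exI[of _ 0])
next
  case (Suc K)
  then have "sign_prob (replicate_mset K a) (x - a) \<noteq> 0 \<or> sign_prob (replicate_mset K a) (x + a) \<noteq> 0"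
    by (auto simp: sign_prob_add_mset)
  then consider t where "x - a = t *\<^sub>R a" | t where "x + a = t *\<^sub>R a"
    using Suc.IH by blast
  then show ?case
  proof cases
    case 1
    then have "x = (t + 1) *\<^sub>R a"
      by (simp add: algebra_simps)
    then show ?thesis ..
  next
    case 2
    then have "x = (t - 1) *\<^sub>R a"
      by (simp add: algebra_simps)
    then show ?thesis ..
  qed
qed

text \<open>By independence \<open>x\<close> splits in at most one way into a multiple of
  \<open>a\<close> plus a multiple of \<open>b\<close>. The convolution thus has at most one nonzero
  term, a product of two probabilities whose squares are at most \<open>1 / 2 ^ m\<close>.\<close>

lemma sign_prob_replicate_pair:
  fixes a b :: complex
  assumes indep: "Im (cnj a * b) \<noteq> 0"
  shows "sign_prob (repeat_mset (2 ^ m) {#a, b#}) x \<le> 1 / 2 ^ m"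
proof -
  define A B where "A = replicate_mset (2 ^ m) a" and "B = replicate_mset (2 ^ m) b"
  have nz: "a \<noteq> 0" "b \<noteq> 0"
    using indep by auto
  have eq: "repeat_mset (2 ^ m) {#a, b#} = A + B"
    by (simp add: A_def B_def multiset_eq_iff)
  define U where "U = {y. sign_prob A y \<noteq> 0}"
  have sum: "sign_prob (A + B) x = (\<Sum>y\<in>U. sign_prob A y * sign_prob B (x - y))"
    by (rule sign_prob_plus) (auto simp: U_def finite_sign_prob_support)
  show ?thesis
  proof (cases "\<exists>y\<in>U. sign_prob B (x - y) \<noteq> 0")
    case True
    then obtain y where y: "y \<in> U" "sign_prob B (x - y) \<noteq> 0"
      by blast
    have unique: "z = y" if z: "z \<in> U" "sign_prob B (x - z) \<noteq> 0" for z
    proof -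
      from y z obtain s t s' t' where st: "y = s *\<^sub>R a" "x - y = t *\<^sub>R b" "z = s' *\<^sub>R a" "x - z = t' *\<^sub>R b"
        unfolding U_def A_def B_def mem_Collect_eq using sign_prob_replicate_support by metis
      \<comment> \<open>Multiplying by \<open>cnj b\<close> and taking imaginary parts annihilates
        the multiples of \<open>b\<close> and leaves the determinant of the pair.\<close>
      have im: "Im (cnj b * (c *\<^sub>R a)) = - (c * Im (cnj a * b))" "Im (cnj b * (c *\<^sub>R b)) = 0" for c :: real
        by (simp_all add: right_diff_distrib mult.commute mult.left_commute)
      have "(s' - s) *\<^sub>R a = (t - t') *\<^sub>R b"
      proof -
        have "(s' - s) *\<^sub>R a = z - y" "(t - t') *\<^sub>R b = (x - y) - (x - z)"
          unfolding scaleR_left_diff_distrib st(2,4) by (simp_all only: st(1,3))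
        then show ?thesis
          by simp
      qed
      then have "cnj b * ((s' - s) *\<^sub>R a) = cnj b * ((t - t') *\<^sub>R b)"
        by (rule arg_cong)
      then have "Im (cnj b * ((s' - s) *\<^sub>R a)) = Im (cnj b * ((t - t') *\<^sub>R b))"
        by (rule arg_cong)
      then have "(s' - s) * Im (cnj a * b) = 0"
        by (simp only: im neg_equal_0_iff_equal)
      then have "s' - s = 0"
        using indep unfolding mult_eq_0_iff by blast
      then show ?thesis
        unfolding st(1,3) by simp
    qed
    have "sign_prob (A + B) x = (\<Sum>z\<in>{y}. sign_prob A z * sign_prob B (x - z))"
      unfolding sum
    proof (rule sum.mono_neutral_right)
      show "finite U"
        by (simp add: U_def finite_sign_prob_support)
      show "\<forall>z\<in>U - {y}. sign_prob A z * sign_prob B (x - z) = 0"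
        using unique by (metis DiffE insertI1 mult_zero_right)
    qed (use y(1) in blast)
    moreover have "sign_prob A y * sign_prob B (x - y) \<le> 1 / 2 ^ m"
      using sum_squares_bound[of "sign_prob A y" "sign_prob B (x - y)"]
        sign_prob_replicate_power2[OF nz(1), of m y] sign_prob_replicate_power2[OF nz(2), of m "x - y"]
      unfolding A_def B_def by simp
    ultimately show ?thesis
      unfolding eq by simp
  next
    case False
    then show ?thesis
      unfolding eq sum by simp
  qed
qed

section \<open>Sign vectors orthogonal to given vectors\<close>

definition signs :: "'i set \<Rightarrow> ('i \<Rightarrow> real) set" where
  "signs J = {r. (\<forall>j\<in>J. r j \<in> {-1, 1}) \<and> (\<forall>j. j \<notin> J \<longrightarrow> r j = 0)}"

lemma signs_insert:
  assumes "j \<notin> J"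
  shows "signs (insert j J) = (\<lambda>r. r(j := 1)) ` signs J \<union> (\<lambda>r. r(j := -1)) ` signs J"
proof
  show "signs (insert j J) \<subseteq> (\<lambda>r. r(j := 1)) ` signs J \<union> (\<lambda>r. r(j := -1)) ` signs J"
  proof
    fix r assume r: "r \<in> signs (insert j J)"
    have "r(j := 0) \<in> signs J" "r = (r(j := 0))(j := r j)" "r j = 1 \<or> r j = -1"
      using r assms by (auto simp: signs_def)
    then show "r \<in> (\<lambda>r. r(j := 1)) ` signs J \<union> (\<lambda>r. r(j := -1)) ` signs J"
      by (metis UnCI image_eqI)
  qed
qed (use assms in \<open>auto simp: signs_def, metis+\<close>)

lemma inj_on_signs_upd:
  assumes "j \<notin> J"
  shows "inj_on (\<lambda>r. r(j := c)) (signs J)"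
proof (rule inj_onI)
  fix r s assume rs: "r \<in> signs J" "s \<in> signs J" "r(j := c) = s(j := c)"
  show "r = s"
  proof
    fix i
    show "r i = s i"
      using rs(1,2) assms fun_cong[OF rs(3), of i] by (cases "i = j") (auto simp: signs_def)
  qed
qed

lemma finite_signs: "finite J \<Longrightarrow> finite (signs J)"
proof (induction J rule: finite_induct)
  case empty
  have "signs ({} :: 'a set) = {\<lambda>_. 0}"
    by (auto simp: signs_def)
  then show ?case
    by simp
qed (simp add: signs_insert)

text \<open>The link between counting and \<open>sign_prob\<close>: fixing the sign at
  \<open>j\<close> shifts the target by \<open>v j\<close> and matches the recursion. The values lie
  in any real vector space, so it serves one vector (reals) and a pair (complex numbers).\<close>

lemma card_signs_sum:
  fixes v :: "'i \<Rightarrow> 'a::real_vector"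
  assumes "finite J"
  shows "real (card {r \<in> signs J. (\<Sum>j\<in>J. r j *\<^sub>R v j) = x})
    = sign_prob (image_mset v (mset_set J)) x * 2 ^ card J"
  using assms
proof (induction J arbitrary: x rule: finite_induct)
  case empty
  have "{r \<in> signs {}. (\<Sum>j\<in>{}. r j *\<^sub>R v j) = x} = (if x = 0 then {\<lambda>_. 0} else {})"
    by (auto simp: signs_def)
  then show ?case
    by (auto simp: sign_prob_empty)
next
  case (insert j J)
  let ?S = "\<lambda>x. {r \<in> signs J. (\<Sum>j\<in>J. r j *\<^sub>R v j) = x}"
  let ?u = "\<lambda>c r. r(j := c) :: 'i \<Rightarrow> real"
  have sum: "(\<Sum>i\<in>insert j J. (r(j := c)) i *\<^sub>R v i) = c *\<^sub>R v j + (\<Sum>i\<in>J. r i *\<^sub>R v i)" for r c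
  proof -
    have "(\<Sum>i\<in>J. (r(j := c)) i *\<^sub>R v i) = (\<Sum>i\<in>J. r i *\<^sub>R v i)"
      using insert.hyps(2) by (intro sum.cong) auto
    then show ?thesis
      using insert.hyps by simp
  qed
  have eq: "{r \<in> signs (insert j J). (\<Sum>j\<in>insert j J. r j *\<^sub>R v j) = x}
      = ?u 1 ` ?S (x - v j) \<union> ?u (-1) ` ?S (x + v j)"
    unfolding signs_insert[OF insert.hyps(2)]
    by (auto simp only: sum) (auto simp: algebra_simps)
  have fin: "finite (?S y)" for y
    using finite_signs[OF insert.hyps(1)] by simp
  have inj: "inj_on (?u c) (?S y)" for c y
    using inj_on_signs_upd[OF insert.hyps(2)] by (rule inj_on_subset) auto
  have disj: "?u 1 ` ?S (x - v j) \<inter> ?u (-1) ` ?S (x + v j) = {}"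
  proof -
    have "?u 1 r \<noteq> ?u (-1) s" for r s
      by (auto dest: fun_cong[where x = j])
    then show ?thesis
      by blast
  qed
  have "card (?u 1 ` ?S (x - v j) \<union> ?u (-1) ` ?S (x + v j)) = card (?S (x - v j)) + card (?S (x + v j))"
    by (subst card_Un_disjoint) (simp_all only: fin finite_imageI disj card_image[OF inj])
  then have "real (card {r \<in> signs (insert j J). (\<Sum>j\<in>insert j J. r j *\<^sub>R v j) = x})
      = real (card (?S (x - v j))) + real (card (?S (x + v j)))"
    unfolding eq by simp
  also have "\<dots> = sign_prob (image_mset v (mset_set (insert j J))) x * 2 ^ card (insert j J)"
    unfolding insert.IH using insert.hyps by (simp add: sign_prob_add_mset algebra_simps)
  finally show ?case .
qed

lemma sign_prob_le_half:
  assumes "a \<noteq> 0"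
  shows "sign_prob {#a#} (x::'a::real_vector) \<le> 1 / 2"
proof -
  have "\<not> (x = a \<and> x + a = 0)"
    using assms by (auto simp flip: scaleR_2)
  then show ?thesis
    by (auto simp: sign_prob_add_mset sign_prob_empty)
qed

text \<open>If all vectors are 0, every sign vector is a solution.\<close>

lemma card_signs:
  assumes "finite J"
  shows "real (card (signs J)) = 2 ^ card J"
proof -
  have "sign_prob (image_mset (\<lambda>_. 0::real) M) 0 = 1" for M :: "'a multiset"
    by (induction M) (simp_all add: sign_prob_empty sign_prob_add_mset)
  then show ?thesis
    using card_signs_sum[OF assms, of "\<lambda>_. 0 :: real" 0] by simp
qed

text \<open>The sign at \<open>j0\<close> alone already takes any prescribed value with probability
  at most 1/2; the other signs cannot increase this.\<close>

lemma card_signs_orthogonal_le_half: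
  assumes "finite J" "j0 \<in> J" "u j0 \<noteq> 0"
  shows "real (card {r \<in> signs J. (\<Sum>j\<in>J. r j * u j) = 0}) \<le> 1 / 2 * 2 ^ card J"
proof -
  have "mset_set J = {#j0#} + mset_set (J - {j0})"
    using assms by (simp add: mset_set.remove)
  then have "sign_prob (image_mset u (mset_set J)) 0 = sign_prob ({#u j0#} + image_mset u (mset_set (J - {j0}))) 0"
    by simp
  also have "\<dots> \<le> 1 / 2"
    using sign_prob_le_half[OF assms(3)] by (rule sign_prob_plus_le)
  finally show ?thesis
    using card_signs_sum[OF assms(1), of u 0] by (simp add: mult_right_mono)
qed

text \<open>The condition \<open>Im (cnj a * b) \<noteq> 0\<close> says that \<open>a\<close> and \<open>b\<close> are linearly independent over \<open>\<real>\<close>.\<close>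

lemma independent_pairs:
  fixes v :: "'i \<Rightarrow> complex"
  assumes "finite J" "\<And>w. w \<noteq> 0 \<Longrightarrow> T \<le> card {j \<in> J. Im (cnj w * v j) \<noteq> 0}" "2 * p \<le> T"
  shows "\<exists>Bs R. length Bs = p \<and> (\<forall>B\<in>set Bs. \<exists>a b. Im (cnj a * b) \<noteq> 0 \<and> B = {#a, b#})
    \<and> image_mset v (mset_set J) = sum_list Bs + R"
  using assms
proof (induction p arbitrary: J T)
  case 0
  show ?case
    by (intro exI[of _ "[]"]) simp
next
  case (Suc p)
  have ex: "\<exists>j\<in>J. Im (cnj w * v j) \<noteq> 0" if "w \<noteq> 0" for w
  proof (rule ccontr)
    assume "\<not> ?thesis"
    then have "{j \<in> J. Im (cnj w * v j) \<noteq> 0} = {}"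
      by blast
    then have "card {j \<in> J. Im (cnj w * v j) \<noteq> 0} = 0"
      by (simp only: card.empty)
    with Suc.prems(2)[OF that] have "T \<le> 0"
      by (rule ord_le_eq_trans)
    then show False
      using Suc.prems(3) by simp
  qed
  \<comment> \<open>\<open>w = 1\<close> yields a column that is not real, hence nonzero; taking
    that column as \<open>w\<close> then yields an independent partner.\<close>
  obtain j where j: "j \<in> J" "v j \<noteq> 0"
    using ex[of 1] by force
  obtain k where k: "k \<in> J" "Im (cnj (v j) * v k) \<noteq> 0"
    using ex[OF j(2)] by blast
  have "j \<noteq> k"
    using k(2) by auto
  define J' where "J' = J - {j} - {k}"
  have J: "mset_set J = {#j, k#} + mset_set J'"
    using Suc.prems(1) j(1) k(1) \<open>j \<noteq> k\<close> by (simp add: J'_def mset_set.remove[of J j] mset_set.remove[of "J - {j}" k])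
  \<comment> \<open>Removing two columns lowers each count by at most 2, just as one pair fewer
    lowers \<open>2 * p\<close>.\<close>
  have "T - 2 \<le> card {i \<in> J'. Im (cnj w * v i) \<noteq> 0}" if "w \<noteq> 0" for w
  proof -
    let ?X = "{i \<in> J. Im (cnj w * v i) \<noteq> 0}"
    have "T - 2 \<le> card ?X - card {j, k}"
      using Suc.prems(2)[OF that] \<open>j \<noteq> k\<close> by (simp add: diff_le_mono)
    also have "\<dots> \<le> card (?X - {j, k})"
      by (rule diff_card_le_card_Diff) simp
    also have "?X - {j, k} = {i \<in> J'. Im (cnj w * v i) \<noteq> 0}"
      by (auto simp: J'_def)
    finally show ?thesis .
  qed
  moreover have "finite J'" "2 * p \<le> T - 2"
    using Suc.prems(1,3) by (auto simp: J'_def)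
  ultimately have "\<exists>Bs R. length Bs = p \<and> (\<forall>B\<in>set Bs. \<exists>a b. Im (cnj a * b) \<noteq> 0 \<and> B = {#a, b#})
      \<and> image_mset v (mset_set J') = sum_list Bs + R"
    by (intro Suc.IH)
  then obtain Bs R where IH: "length Bs = p" "\<forall>B\<in>set Bs. \<exists>a b. Im (cnj a * b) \<noteq> 0 \<and> B = {#a, b#}"
      "image_mset v (mset_set J') = sum_list Bs + R"
    by blast
  show ?case
    using IH k(2) by (intro exI[of _ "{#v j, v k#} # Bs"] exI[of _ R]) (auto simp: J)
qed

text \<open>Reading columns as complex numbers merges both equations into one signed sum in the
  plane. By \<open>supp\<close>, at least \<open>T\<close> columns lie off every line through the
  origin, which provides the disjoint independent pairs.\<close>

lemma card_signs_orthogonal_pair: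
  fixes u1 u2 :: "'i \<Rightarrow> real"
  assumes J: "finite J" and T: "T > 0"
    and supp: "\<And>a b. (a, b) \<noteq> (0, 0) \<Longrightarrow> T \<le> card {j \<in> J. a * u1 j + b * u2 j \<noteq> 0}"
  shows "real (card {r \<in> signs J. (\<Sum>j\<in>J. r j * u1 j) = 0 \<and> (\<Sum>j\<in>J. r j * u2 j) = 0})
    \<le> 4 / real T * 2 ^ card J"
proof -
  define v where "v j = Complex (u1 j) (u2 j)" for j
  have eq: "{r \<in> signs J. (\<Sum>j\<in>J. r j * u1 j) = 0 \<and> (\<Sum>j\<in>J. r j * u2 j) = 0}
      = {r \<in> signs J. (\<Sum>j\<in>J. r j *\<^sub>R v j) = 0}"
    by (simp add: complex_eq_iff v_def)
  have le: "sign_prob (image_mset v (mset_set J)) 0 \<le> 4 / real T"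
  proof (cases "T = 1")
    case True
    have "sign_prob A x \<le> 1" for A :: "complex multiset" and x
      using sign_prob_plus_le[of "{#}" 1 A x] by (simp add: sign_prob_empty)
    from order_trans[OF this] True show ?thesis
      by simp
  next
    case False
    with T have "1 \<le> T div 2"
      by simp
    \<comment> \<open>The halving argument needs a power of two as the number of pairs. Rounding
      \<open>T / 2\<close> down to one gives \<open>T \<le> 4 * 2 ^ m\<close>, the source of the
      constant 4.\<close>
    then obtain m where m: "2 ^ m \<le> T div 2" "T div 2 < 2 ^ (m + 1)"
      using ex_power_ivl1[of 2 "T div 2"] by auto
    have "T \<le> card {j \<in> J. Im (cnj w * v j) \<noteq> 0}" if "w \<noteq> 0" for w
    proof -
      have "T \<le> card {j \<in> J. (- Im w) * u1 j + Re w * u2 j \<noteq> 0}"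
        using that by (intro supp) (auto simp: complex_eq_iff)
      then show ?thesis
        by (simp add: v_def add.commute)
    qed
    moreover have "2 * 2 ^ m \<le> T"
      using m(1) by simp
    ultimately have "\<exists>Bs R. length Bs = 2 ^ m \<and> (\<forall>B\<in>set Bs. \<exists>a b. Im (cnj a * b) \<noteq> 0 \<and> B = {#a, b#})
        \<and> image_mset v (mset_set J) = sum_list Bs + R"
      by (rule independent_pairs[OF J])
    then obtain Bs R where Bs: "length Bs = 2 ^ m"
        "\<And>B. B \<in> set Bs \<Longrightarrow> \<exists>a b. Im (cnj a * b) \<noteq> 0 \<and> B = {#a, b#}"
        "image_mset v (mset_set J) = sum_list Bs + R"
      by blast
    have "sign_prob (repeat_mset 1 (sum_list Bs)) x \<le> 1 / 2 ^ m" for x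
      using Bs(1)
    proof (rule sign_prob_sum_list_le)
      fix B y assume "B \<in> set Bs"
      then show "sign_prob (repeat_mset (1 * 2 ^ m) B) y \<le> 1 / 2 ^ m"
        using Bs(2)[of B] by (metis mult_1 sign_prob_replicate_pair)
    qed
    then have "sign_prob (image_mset v (mset_set J)) 0 \<le> 1 / 2 ^ m"
      unfolding Bs(3) by (intro sign_prob_plus_le) simp
    also have "\<dots> \<le> 4 / real T"
    proof -
      have "T \<le> 4 * 2 ^ m"
        using m(2) by simp
      then have "real T \<le> real (4 * 2 ^ m)"
        by (simp only: of_nat_le_iff)
      with T show ?thesis
        by (simp add: field_simps)
    qed
    finally show ?thesis .
  qed
  show ?thesis
    unfolding eq card_signs_sum[OF J] by (intro mult_right_mono le) simp
qed

section \<open>Union bound over supports and row sets\<close>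

text \<open>Gaussian elimination over the columns: each column of \<open>S\<close> needs at most one
  pivot row, and the pivot rows imply all other equations.\<close>

lemma row_selection:
  fixes A :: "'i \<Rightarrow> 'j \<Rightarrow> real"
  assumes "finite S"
  shows "\<exists>I\<subseteq>H. finite I \<and> card I \<le> card S \<and>
    (\<forall>u. (\<forall>i\<in>I. (\<Sum>j\<in>S. A i j * u j) = 0) \<longrightarrow> (\<forall>i\<in>H. (\<Sum>j\<in>S. A i j * u j) = 0))"
  using assms
proof (induction S arbitrary: A rule: finite_induct)
  case empty
  then show ?case
    by (intro exI[of _ "{}"]) simp
next
  case (insert k S)
  show ?case
  proof (cases "\<forall>i\<in>H. A i k = 0")
    case True
    obtain I where I: "I \<subseteq> H" "finite I" "card I \<le> card S"
      "\<And>u. (\<forall>i\<in>I. (\<Sum>j\<in>S. A i j * u j) = 0) \<Longrightarrow> (\<forall>i\<in>H. (\<Sum>j\<in>S. A i j * u j) = 0)"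
      using insert.IH[of A] by blast
    have "(\<Sum>j\<in>insert k S. A i j * u j) = (\<Sum>j\<in>S. A i j * u j)" if "i \<in> H" for i u
      using True that insert.hyps by simp
    then have "\<forall>i\<in>H. (\<Sum>j\<in>insert k S. A i j * u j) = 0"
      if "\<forall>i\<in>I. (\<Sum>j\<in>insert k S. A i j * u j) = 0" for u
      using I(1) I(4)[of u] that by (metis subsetD)
    moreover have "card I \<le> card (insert k S)"
      using I(3) insert.hyps by simp
    ultimately show ?thesis
      using I(1,2) by blast
  next
    case False
    then obtain i0 where i0: "i0 \<in> H" "A i0 k \<noteq> 0"
      by blast
    \<comment> \<open>The matrix after clearing column \<open>k\<close> with pivot row
      \<open>i0\<close>. On vectors that satisfy the pivot equation it agrees with
      \<open>A\<close>.\<close>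
    define B where "B i j = A i j - A i k / A i0 k * A i0 j" for i j
    obtain I where I: "I \<subseteq> H" "finite I" "card I \<le> card S"
      "\<And>u. (\<forall>i\<in>I. (\<Sum>j\<in>S. B i j * u j) = 0) \<Longrightarrow> (\<forall>i\<in>H. (\<Sum>j\<in>S. B i j * u j) = 0)"
      using insert.IH[of B] by blast
    have elim: "(\<Sum>j\<in>insert k S. A i j * u j) = (\<Sum>j\<in>S. B i j * u j)"
      if "(\<Sum>j\<in>insert k S. A i0 j * u j) = 0" for i u
    proof -
      have "(\<Sum>j\<in>S. A i0 j * u j) = - (A i0 k * u k)"
        using that insert.hyps by simp
      moreover have "(\<Sum>j\<in>S. B i j * u j) = (\<Sum>j\<in>S. A i j * u j) - A i k / A i0 k * (\<Sum>j\<in>S. A i0 j * u j)"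
        by (simp add: B_def left_diff_distrib sum_subtractf sum_distrib_left mult.assoc)
      ultimately show ?thesis
        using i0 insert.hyps by simp
    qed
    show ?thesis
    proof (intro exI[of _ "insert i0 I"] conjI allI impI)
      show "card (insert i0 I) \<le> card (insert k S)"
        using I(2,3) insert.hyps card_insert_le_m1 by (simp add: card_insert_if)
      fix u assume u: "\<forall>i\<in>insert i0 I. (\<Sum>j\<in>insert k S. A i j * u j) = 0"
      then have "\<forall>i\<in>I. (\<Sum>j\<in>S. B i j * u j) = 0"
        using elim[of u] by simp
      from I(4)[OF this] show "\<forall>i\<in>H. (\<Sum>j\<in>insert k S. A i j * u j) = 0"
        using elim[of u] u by simp
    qed (use I i0 in auto)
  qed
qed

section \<open>Sign matrices as families of independent rows\<close>

lemma mem_pm_matrices_iff: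
  "M \<in> pm_matrices h N \<longleftrightarrow> (\<forall>i<h. M i \<in> signs {..<N}) \<and> (\<forall>i\<ge>h. M i = (\<lambda>_. 0))"
proof
  assume M: "M \<in> pm_matrices h N"
  show "(\<forall>i<h. M i \<in> signs {..<N}) \<and> (\<forall>i\<ge>h. M i = (\<lambda>_. 0))"
  proof (intro conjI allI impI)
    fix i assume "h \<le> i"
    show "M i = (\<lambda>_. 0)"
    proof
      fix j
      have "\<not> (i < h \<and> j < N)"
        using \<open>h \<le> i\<close> by simp
      then show "M i j = 0"
        using M unfolding pm_matrices_def by blast
    qed
  qed (use M in \<open>unfold pm_matrices_def signs_def, blast\<close>)
next
  assume M: "(\<forall>i<h. M i \<in> signs {..<N}) \<and> (\<forall>i\<ge>h. M i = (\<lambda>_. 0))"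
  show "M \<in> pm_matrices h N"
    unfolding pm_matrices_def mem_Collect_eq
  proof (intro conjI allI impI)
    fix i j
    show "M i j \<in> {-1, 1}" if "i < h \<and> j < N"
      using M that unfolding signs_def by blast
    show "M i j = 0" if "\<not> (i < h \<and> j < N)"
      using M that unfolding signs_def by (cases "i < h") simp_all
  qed
qed

text \<open>Only the default outside the index range changes, from 0 to \<open>undefined\<close>;
  finiteness and cardinality then come from \<open>PiE\<close>.\<close>

lemma bij_betw_pm_matrices:
  "bij_betw (\<lambda>M. restrict M {..<h}) (pm_matrices h N) (PiE {..<h} (\<lambda>_. signs {..<N}))"
proof (rule bij_betw_byWitness[where f' = "\<lambda>F i. if i < h then F i else (\<lambda>_. 0)"])
  show "\<forall>M\<in>pm_matrices h N. (\<lambda>i. if i < h then restrict M {..<h} i else (\<lambda>_. 0)) = M"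
  proof (rule ballI, rule ext)
    fix M i assume "M \<in> pm_matrices h N"
    then have "M i = (\<lambda>_. 0)" if "\<not> i < h"
      using that unfolding mem_pm_matrices_iff by simp
    then show "(if i < h then restrict M {..<h} i else (\<lambda>_. 0)) = M i"
      by (cases "i < h") simp_all
  qed
  show "\<forall>F\<in>PiE {..<h} (\<lambda>_. signs {..<N}). restrict (\<lambda>i. if i < h then F i else (\<lambda>_. 0)) {..<h} = F"
  proof (rule ballI, rule ext)
    fix F i assume "F \<in> PiE {..<h} (\<lambda>_. signs {..<N})"
    then have "F i = undefined" if "\<not> i < h"
      using that PiE_arb[of F "{..<h}" "\<lambda>_. signs {..<N}" i] by simp
    then show "restrict (\<lambda>i. if i < h then F i else (\<lambda>_. 0)) {..<h} i = F i"
      by (cases "i < h") simp_all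
  qed
  show "(\<lambda>M. restrict M {..<h}) ` pm_matrices h N \<subseteq> PiE {..<h} (\<lambda>_. signs {..<N})"
    by (auto simp: mem_pm_matrices_iff)
  show "(\<lambda>F i. if i < h then F i else (\<lambda>_. 0)) ` PiE {..<h} (\<lambda>_. signs {..<N}) \<subseteq> pm_matrices h N"
  proof
    fix M assume "M \<in> (\<lambda>F i. if i < h then F i else (\<lambda>_. 0)) ` PiE {..<h} (\<lambda>_. signs {..<N})"
    then obtain F where "F \<in> PiE {..<h} (\<lambda>_. signs {..<N})" "M = (\<lambda>i. if i < h then F i else (\<lambda>_. 0))"
      by (rule imageE)
    then show "M \<in> pm_matrices h N"
      unfolding mem_pm_matrices_iff using PiE_mem[of F "{..<h}" "\<lambda>_. signs {..<N}"] by simp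
  qed
qed

lemma finite_pm_matrices: "finite (pm_matrices h N)"
  using bij_betw_finite[OF bij_betw_pm_matrices] by (simp add: finite_PiE finite_signs)

lemma card_pm_matrices: "real (card (pm_matrices h N)) = (2 ^ N) ^ h"
  using bij_betw_same_card[OF bij_betw_pm_matrices[of h N]] by (simp add: card_PiE card_signs)

text \<open>Conditioning on the rows in \<open>I\<close>: once they are chosen, the allowed set for
  the remaining rows is fixed, and each of these \<open>h - card I\<close> rows has at most
  \<open>q * 2 ^ N\<close> choices.\<close>

lemma card_rows_determined_le:
  fixes R :: "(nat \<Rightarrow> nat \<Rightarrow> real) \<Rightarrow> (nat \<Rightarrow> real) set"
  assumes I: "I \<subseteq> {..<h}" and R: "\<And>F. R F \<subseteq> signs {..<N}" "\<And>F. real (card (R F)) \<le> q * 2 ^ N"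
  shows "real (card {M \<in> pm_matrices h N. \<forall>i\<in>{..<h} - I. M i \<in> R (restrict M I)})
    \<le> q ^ (h - card I) * real (card (pm_matrices h N))"
proof -
  have finI: "finite I"
    using I finite_subset by blast
  have cardI: "card I \<le> h"
    using card_mono[OF _ I] by simp
  have finR: "finite (R F)" for F
    using R(1) finite_signs finite_subset finite_lessThan by metis
  let ?f = "\<lambda>M :: nat \<Rightarrow> nat \<Rightarrow> real. (restrict M I, restrict M ({..<h} - I))"
  let ?E = "{M \<in> pm_matrices h N. \<forall>i\<in>{..<h} - I. M i \<in> R (restrict M I)}"
  let ?S = "Sigma (PiE I (\<lambda>_. signs {..<N})) (\<lambda>F. PiE ({..<h} - I) (\<lambda>_. R F))"
  have "inj_on ?f ?E"
  proof (rule inj_onI)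
    fix M M' assume M: "M \<in> ?E" "M' \<in> ?E" and eq: "?f M = ?f M'"
    show "M = M'"
    proof (rule ext)
      fix i
      consider "i \<in> I" | "i \<in> {..<h} - I" | "i \<ge> h"
        by force
      then show "M i = M' i"
      proof cases
        case 1
        then show ?thesis
          using eq by (metis prod.inject restrict_apply')
      next
        case 2
        then show ?thesis
          using eq by (metis prod.inject restrict_apply')
      next
        case 3
        then show ?thesis
          using M by (simp add: mem_pm_matrices_iff)
      qed
    qed
  qed
  moreover have "?f ` ?E \<subseteq> ?S"
    using I by (auto simp: mem_pm_matrices_iff)
  moreover have fin: "finite ?S"
    by (intro finite_SigmaI finite_PiE finI finite_signs finR finite_Diff) auto
  ultimately have "card ?E \<le> card ?S"
    by (rule card_inj_on_le)
  also have "card ?S = (\<Sum>F\<in>PiE I (\<lambda>_. signs {..<N}). card (R F) ^ (h - card I))"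
    using finI I by (simp add: card_SigmaI finite_PiE finite_signs finR card_PiE card_Diff_subset)
  finally have "real (card ?E) \<le> (\<Sum>F\<in>PiE I (\<lambda>_. signs {..<N}). real (card (R F)) ^ (h - card I))"
    by (metis (mono_tags, lifting) of_nat_le_iff of_nat_power of_nat_sum sum.cong)
  also have "\<dots> \<le> (\<Sum>F\<in>PiE I (\<lambda>_. signs {..<N}). (q * 2 ^ N) ^ (h - card I))"
    by (intro sum_mono power_mono R(2)) auto
  also have "\<dots> = q ^ (h - card I) * ((2 ^ N) ^ card I * (2 ^ N) ^ (h - card I))"
    using finI by (simp add: card_PiE card_signs power_mult_distrib)
  also have "\<dots> = q ^ (h - card I) * real (card (pm_matrices h N))"
    using cardI by (simp add: card_pm_matrices flip: power_add)
  finally show ?thesis .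
qed

text \<open>Some \<open>s\<close> rows \<open>I\<close> already determine the kernel vectors supported in \<open>S\<close>. Hence a witness \<open>V\<close> can be
  chosen as a function of these rows only, and each of the other \<open>h - s\<close> rows is orthogonal to it with
  probability at most \<open>q\<close>.\<close>

lemma card_kernel_contains_le:
  fixes \<V> :: "(nat \<Rightarrow> real) set set"
  assumes q: "\<And>V. V \<in> \<V> \<Longrightarrow> real (card {r \<in> signs {..<N}. \<forall>u\<in>V. (\<Sum>j<N. r j * u j) = 0}) \<le> q * 2 ^ N"
    and "0 \<le> q" "s \<le> h" "s \<le> N"
  shows "real (card {M \<in> pm_matrices h N. \<exists>S\<subseteq>{..<N}. card S = s \<and>
      (\<exists>V\<in>\<V>. \<forall>u\<in>V. supp u \<subseteq> S \<and> u \<in> matrix_kernel h N M)})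
    \<le> real N ^ s * real h ^ s * q ^ (h - s) * real (card (pm_matrices h N))"
    (is "real (card ?B) \<le> _")
proof -
  define \<S> where "\<S> n = {S. S \<subseteq> {..<n} \<and> card S = s}" for n :: nat
  define P where "P S I F V \<longleftrightarrow> V \<in> \<V> \<and> (\<forall>u\<in>V. supp u \<subseteq> S \<and> (\<forall>i\<in>I. (\<Sum>j<N. F i j * u j) = 0))"
    for S I and F :: "nat \<Rightarrow> nat \<Rightarrow> real" and V
  \<comment> \<open>The chosen witness depends only on \<open>S\<close> and the rows in
    \<open>I\<close>. Without a witness the set is empty, so the bound by \<open>q\<close> holds in
    either case.\<close>
  define R where "R S I F = (if \<exists>V. P S I F V
      then {r \<in> signs {..<N}. \<forall>u\<in>(SOME V. P S I F V). (\<Sum>j<N. r j * u j) = 0} else {})"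
    for S I and F :: "nat \<Rightarrow> nat \<Rightarrow> real"
  define E where "E S I = {M \<in> pm_matrices h N. \<forall>i\<in>{..<h} - I. M i \<in> R S I (restrict M I)}" for S I
  have card_E: "real (card (E S I)) \<le> q ^ (h - s) * real (card (pm_matrices h N))" if "I \<in> \<S> h" for S I
  proof -
    have I: "I \<subseteq> {..<h}" "card I = s"
      using that by (auto simp: \<S>_def)
    have "real (card (R S I F)) \<le> q * 2 ^ N" for F
    proof (cases "\<exists>V. P S I F V")
      case True
      then have "P S I F (SOME V. P S I F V)"
        by (rule someI_ex)
      then have "(SOME V. P S I F V) \<in> \<V>"
        by (simp add: P_def)
      from q[OF this] True show ?thesis
        by (simp add: R_def)
    next
      case False
      then show ?thesis
        using \<open>0 \<le> q\<close> by (simp add: R_def)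
    qed
    moreover have "R S I F \<subseteq> signs {..<N}" for F
      by (auto simp: R_def)
    ultimately show ?thesis
      using card_rows_determined_le[OF I(1), of "R S I" N q] I(2) by (simp add: E_def)
  qed
  have fin: "finite (\<S> n)" for n
    by (simp add: \<S>_def)
  have card_\<S>: "real (card (\<S> n)) \<le> real n ^ s" if "s \<le> n" for n
    using binomial_le_pow[OF that] n_subsets[of "{..<n}" s]
    by (simp add: \<S>_def flip: of_nat_power)
  have "?B \<subseteq> (\<Union>(S, I)\<in>\<S> N \<times> \<S> h. E S I)"
  proof
    fix M assume "M \<in> ?B"
    then obtain S V where M: "M \<in> pm_matrices h N" and S: "S \<subseteq> {..<N}" "card S = s" and V: "V \<in> \<V>"
      "\<And>u. u \<in> V \<Longrightarrow> supp u \<subseteq> S" "\<And>u. u \<in> V \<Longrightarrow> u \<in> matrix_kernel h N M"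
      by auto
    have finS: "finite S"
      using S(1) finite_subset by blast
    obtain I0 where I0: "I0 \<subseteq> {..<h}" "card I0 \<le> s"
      and ker0: "\<And>u. (\<forall>i\<in>I0. (\<Sum>j\<in>S. M i j * u j) = 0) \<Longrightarrow> (\<forall>i\<in>{..<h}. (\<Sum>j\<in>S. M i j * u j) = 0)"
      using row_selection[OF finS, of "{..<h}" M] S(2) by blast
    \<comment> \<open>Padding to exactly \<open>s\<close> rows makes the exponent
      \<open>h - s\<close> the same for all terms of the union.\<close>
    obtain I where I: "I0 \<subseteq> I" "I \<subseteq> {..<h}" "card I = s"
      using exists_subset_between[of I0 s "{..<h}"] I0 \<open>s \<le> h\<close> by auto
    have restr: "(\<Sum>j<N. M i j * u j) = (\<Sum>j\<in>S. M i j * u j)" if "supp u \<subseteq> S" for i u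
      using that S(1) by (intro sum.mono_neutral_right) (auto simp: supp_def)
    have "P S I (restrict M I) V"
      using V I(2) by (auto simp: P_def matrix_kernel_def)
    then have ex: "\<exists>V. P S I (restrict M I) V"
      by blast
    \<comment> \<open>\<open>W\<close> may differ from \<open>V\<close>. It is supported in
      \<open>S\<close> and orthogonal to the rows in \<open>I\<close>, hence, by the choice of
      \<open>I0\<close>, to all rows of \<open>M\<close>.\<close>
    define W where "W = (SOME V. P S I (restrict M I) V)"
    have W: "P S I (restrict M I) W"
      unfolding W_def by (rule someI_ex[OF ex])
    have "M i \<in> R S I (restrict M I)" if i: "i \<in> {..<h} - I" for i
    proof -
      have "(\<Sum>j<N. M i j * u j) = 0" if u: "u \<in> W" for u
      proof -
        have "supp u \<subseteq> S" "\<forall>k\<in>I. (\<Sum>j<N. M k j * u j) = 0"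
          using W u by (auto simp: P_def)
        then show ?thesis
          using ker0[of u] I(1) i restr[of u] by auto
      qed
      moreover have "M i \<in> signs {..<N}"
        using M i by (simp add: mem_pm_matrices_iff)
      ultimately show ?thesis
        using ex by (simp add: R_def flip: W_def)
    qed
    then have "M \<in> E S I"
      using M by (simp add: E_def)
    then show "M \<in> (\<Union>(S, I)\<in>\<S> N \<times> \<S> h. E S I)"
      using S I by (auto simp: \<S>_def)
  qed
  then have "card ?B \<le> card (\<Union>(S, I)\<in>\<S> N \<times> \<S> h. E S I)"
    by (rule card_mono[rotated]) (auto simp: fin E_def finite_pm_matrices)
  also have "\<dots> \<le> (\<Sum>(S, I)\<in>\<S> N \<times> \<S> h. card (E S I))"
    using card_UN_le[of "\<S> N \<times> \<S> h" "\<lambda>(S, I). E S I"] fin by (simp add: case_prod_unfold)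
  finally have "real (card ?B) \<le> real (\<Sum>(S, I)\<in>\<S> N \<times> \<S> h. card (E S I))"
    by (simp only: of_nat_le_iff)
  also have "\<dots> = (\<Sum>(S, I)\<in>\<S> N \<times> \<S> h. real (card (E S I)))"
    by (simp add: case_prod_unfold)
  also have "\<dots> \<le> (\<Sum>(S, I)\<in>\<S> N \<times> \<S> h. q ^ (h - s) * real (card (pm_matrices h N)))"
    by (rule sum_mono) (auto simp: card_E)
  also have "\<dots> = real (card (\<S> N)) * real (card (\<S> h)) * (q ^ (h - s) * real (card (pm_matrices h N)))"
    by (simp add: card_cartesian_product)
  also have "\<dots> \<le> real N ^ s * real h ^ s * (q ^ (h - s) * real (card (pm_matrices h N)))"
    using \<open>0 \<le> q\<close> by (intro mult_right_mono mult_mono card_\<S> assms) auto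
  finally show ?thesis
    by (simp add: mult.assoc)
qed

lemma matrix_kernel_lin_comb:
  assumes "u \<in> matrix_kernel h N M" "v \<in> matrix_kernel h N M"
  shows "(\<lambda>j. a * u j + b * v j) \<in> matrix_kernel h N M"
proof -
  have "(\<Sum>j<N. M i j * (a * u j + b * v j)) = a * (\<Sum>j<N. M i j * u j) + b * (\<Sum>j<N. M i j * v j)" for i
    by (simp add: sum_distrib_left sum.distrib algebra_simps)
  with assms show ?thesis
    by (simp add: matrix_kernel_def)
qed

text \<open>A matrix with small \<open>d2\<close> has a light nonzero kernel vector or a kernel pair
  without light combinations; each event gets its own union bound. The hypothesis on
  \<open>x\<close> lets supports of size below \<open>x\<close> be padded to exactly
  \<open>s\<close>.\<close>

lemma prob_d2_ge:
  assumes T: "0 < T" "T \<le> h" "T \<le> N" and s: "s \<le> h" "s \<le> N"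
    and x: "\<And>n. real n < x \<Longrightarrow> n \<le> s"
  shows "1 - (real N ^ T * real h ^ T * (1 / 2) ^ (h - T) + real N ^ s * real h ^ s * (4 / real T) ^ (h - s))
    \<le> real (card {M \<in> pm_matrices h N. ereal x \<le> d2 (matrix_kernel h N M)}) / real (card (pm_matrices h N))"
proof -
  let ?K = "matrix_kernel h N"
  define B where "B s \<V> = {M \<in> pm_matrices h N. \<exists>S\<subseteq>{..<N}. card S = s \<and>
      (\<exists>V\<in>\<V>. \<forall>u\<in>V. supp u \<subseteq> S \<and> u \<in> ?K M)}" for s and \<V> :: "(nat \<Rightarrow> real) set set"
  define \<V>1 :: "(nat \<Rightarrow> real) set set" where "\<V>1 = {{u} | u. \<exists>j<N. u j \<noteq> 0}"
  define wide where "wide u v \<longleftrightarrow> (\<forall>a b. (a, b) \<noteq> (0, 0) \<longrightarrow> T \<le> card {j \<in> {..<N}. a * u j + b * v j \<noteq> 0})"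
    for u v :: "nat \<Rightarrow> real"
  define \<V>2 where "\<V>2 = {{u, v} | u v. wide u v}"
  have B1: "real (card (B T \<V>1)) \<le> real N ^ T * real h ^ T * (1 / 2) ^ (h - T) * real (card (pm_matrices h N))"
    unfolding B_def
  proof (rule card_kernel_contains_le)
    fix V assume "V \<in> \<V>1"
    then obtain u j where "V = {u}" "j < N" "u j \<noteq> 0"
      by (auto simp: \<V>1_def)
    then show "real (card {r \<in> signs {..<N}. \<forall>u\<in>V. (\<Sum>j<N. r j * u j) = 0}) \<le> 1 / 2 * 2 ^ N"
      using card_signs_orthogonal_le_half[of "{..<N}" j u] by simp
  qed (use T in auto)
  have B2: "real (card (B s \<V>2)) \<le> real N ^ s * real h ^ s * (4 / real T) ^ (h - s) * real (card (pm_matrices h N))"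
    unfolding B_def
  proof (rule card_kernel_contains_le)
    fix V assume "V \<in> \<V>2"
    then obtain u v where "V = {u, v}" "wide u v"
      by (auto simp: \<V>2_def)
    then show "real (card {r \<in> signs {..<N}. \<forall>u\<in>V. (\<Sum>j<N. r j * u j) = 0}) \<le> 4 / real T * 2 ^ N"
      using card_signs_orthogonal_pair[of "{..<N}" T u v] T(1) by (simp add: wide_def)
  qed (use s in auto)
  let ?G = "{M \<in> pm_matrices h N. ereal x \<le> d2 (?K M)}"
  have "pm_matrices h N \<subseteq> ?G \<union> (B T \<V>1 \<union> B s \<V>2)"
  proof
    fix M assume M: "M \<in> pm_matrices h N"
    show "M \<in> ?G \<union> (B T \<V>1 \<union> B s \<V>2)"
    proof (cases "ereal x \<le> d2 (?K M)")
      case False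
      then have "d2 (?K M) < ereal x"
        by simp
      then obtain u v where uv: "u \<in> ?K M" "v \<in> ?K M" "lin_indep2 u v" "real (card (supp u \<union> supp v)) < x"
        unfolding d2_def Inf_less_iff by auto
      have supp_N: "supp w \<subseteq> {..<N}" if "w \<in> ?K M" for w
        using that by (auto simp: matrix_kernel_def supp_def not_le[symmetric])
      show ?thesis
      proof (cases "wide u v")
        case True
        obtain S where S: "supp u \<union> supp v \<subseteq> S" "S \<subseteq> {..<N}" "card S = s"
          using exists_subset_between[of "supp u \<union> supp v" s "{..<N}"] x[OF uv(4)] s supp_N uv by auto
        have "{u, v} \<in> \<V>2"
          using True by (auto simp: \<V>2_def)
        moreover have "\<forall>w\<in>{u, v}. supp w \<subseteq> S \<and> w \<in> ?K M"
          using S uv by simp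
        ultimately have "M \<in> B s \<V>2"
          using M S(2,3) unfolding B_def by blast
        then show ?thesis
          by simp
      next
        case False
        then obtain a b where ab: "(a, b) \<noteq> (0, 0)" "card {j \<in> {..<N}. a * u j + b * v j \<noteq> 0} < T"
          by (auto simp: wide_def not_le)
        define w where "w j = a * u j + b * v j" for j
        have w: "w \<in> ?K M"
          unfolding w_def using uv by (intro matrix_kernel_lin_comb)
        then have "supp w = {j \<in> {..<N}. a * u j + b * v j \<noteq> 0}"
          using supp_N[OF w] by (auto simp: supp_def w_def)
        then have "card (supp w) \<le> T"
          using ab(2) by simp
        then obtain S where S: "supp w \<subseteq> S" "S \<subseteq> {..<N}" "card S = T"
          using exists_subset_between[of "supp w" T "{..<N}"] T supp_N[OF w] by auto
        \<comment> \<open>Linear independence makes the light combination nonzero.\<close>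
        obtain j where j: "w j \<noteq> 0"
          using uv(3) ab(1) unfolding lin_indep2_def w_def by blast
        then have "j < N"
          using supp_N[OF w] by (auto simp: supp_def)
        with j have "{w} \<in> \<V>1"
          by (auto simp: \<V>1_def)
        moreover have "\<forall>w'\<in>{w}. supp w' \<subseteq> S \<and> w' \<in> ?K M"
          using S w by simp
        ultimately have "M \<in> B T \<V>1"
          using M S(2,3) unfolding B_def by blast
        then show ?thesis
          by simp
      qed
    qed (use M in simp)
  qed
  then have "card (pm_matrices h N) \<le> card (?G \<union> (B T \<V>1 \<union> B s \<V>2))"
    by (rule card_mono[rotated]) (auto simp: B_def finite_pm_matrices)
  also have "\<dots> \<le> card ?G + (card (B T \<V>1) + card (B s \<V>2))"
    by (meson add_left_mono card_Un_le order_trans)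
  finally have "real (card (pm_matrices h N)) \<le> real (card ?G) + (real (card (B T \<V>1)) + real (card (B s \<V>2)))"
    by (simp only: of_nat_le_iff flip: of_nat_add)
  moreover have "real (card (pm_matrices h N)) > 0"
    unfolding card_pm_matrices by simp
  moreover have "1 - (e1 + e2) \<le> g / p" if "p \<le> g + (b1 + b2)" "0 < p" "b1 \<le> e1 * p" "b2 \<le> e2 * p"
    for p g b1 b2 e1 e2 :: real
    using that by (simp add: pos_le_divide_eq left_diff_distrib distrib_right)
  ultimately show ?thesis
    using B1 B2 by blast
qed

section \<open>Asymptotics\<close>

text \<open>Solving the defining inequality for \<open>N\<close> bounds all candidates, so that
  \<open>GREATEST\<close> is attained. Since \<open>4 \<le> d\<close>, the base
  \<open>sqrt d\<close> is at least 2, and \<open>2 * d\<close> is a candidate.\<close>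

lemma
  assumes d: "2 * d \<le> h" "4 \<le> d"
  shows bigN_ge: "2 * d \<le> bigN h d"
    and ln_bigN_le: "ln (real (bigN h d)) \<le> ln (real d) + real h / (2 * real d) * ln (real d)"
proof -
  define P where "P N \<longleftrightarrow> real d * log (sqrt (real d)) (real N / real d) \<le> real h" for N :: nat
  have bigN: "bigN h d = (GREATEST N. P N)"
    by (simp add: bigN_def P_def)
  have base: "sqrt (real d) \<ge> 2"
    using d(2) by (intro real_le_rsqrt) simp
  then have base1: "sqrt (real d) > 1"
    by linarith
  have ub: "real N \<le> real d * sqrt (real d) powr (real h / real d)" if "P N" for N
  proof (cases "N = 0")
    case False
    have "log (sqrt (real d)) (real N / real d) \<le> real h / real d"
      using that d(2) by (simp add: P_def field_simps)
    then have "real N / real d \<le> sqrt (real d) powr (real h / real d)"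
      using False d(2) base1 by (subst (asm) log_le_iff) auto
    then show ?thesis
      using d(2) by (simp add: field_simps)
  qed simp
  have bound: "N \<le> nat \<lceil>real d * sqrt (real d) powr (real h / real d)\<rceil>" if "P N" for N
    using ub[OF that] by linarith
  have "log (sqrt (real d)) 2 \<le> 1"
    using base base1 by (subst log_le_one_cancel_iff) auto
  then have "real d * log (sqrt (real d)) 2 \<le> real d"
    by (rule mult_left_le) simp
  then have "real d * log (sqrt (real d)) 2 \<le> real h"
    using d(1) by linarith
  then have "P (2 * d)"
    using d(2) by (simp add: P_def)
  then show ge: "2 * d \<le> bigN h d"
    unfolding bigN by (rule Greatest_le_nat) (rule bound)
  have "P (bigN h d)"
    unfolding bigN using \<open>P (2 * d)\<close> by (rule GreatestI_nat) (rule bound)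
  then have "real (bigN h d) \<le> real d * sqrt (real d) powr (real h / real d)"
    by (rule ub)
  then have "ln (real (bigN h d)) \<le> ln (real d * sqrt (real d) powr (real h / real d))"
    using ge d(2) by (subst ln_le_cancel_iff) auto
  also have "\<dots> = ln (real d) + real h / (2 * real d) * ln (real d)"
    using d(2) by (simp add: ln_mult ln_powr ln_sqrt)
  finally show "ln (real (bigN h d)) \<le> ln (real d) + real h / (2 * real d) * ln (real d)" .
qed

text \<open>Since \<open>h / (2 * d) \<le> 1 / (2 * \<delta>)\<close>, \<open>ln N\<close> is of
  order \<open>ln h\<close>. In the exponent, \<open>T' * ln 2\<close> pays for using only
  \<open>h - T\<close> of the \<open>h\<close> rows.\<close>

lemma light_vector_bound:
  fixes N T h :: nat and \<delta> d T' :: real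
  assumes "0 < N" "0 < h" "T \<le> h" "0 < \<delta>" "\<delta> * real h \<le> d" "1 \<le> d" "d \<le> real h"
    and N: "ln (real N) \<le> ln d + real h / (2 * d) * ln d" and T: "real T \<le> T'"
  shows "real N ^ T * real h ^ T * (1 / 2) ^ (h - T)
    \<le> exp (T' * ((2 + 1 / (2 * \<delta>)) * ln (real h) + ln 2) - real h * ln 2)"
proof -
  have L: "0 \<le> ln d" "ln d \<le> ln (real h)" "0 \<le> ln (real h)"
    using assms by auto
  have "real h / (2 * d) \<le> 1 / (2 * \<delta>)"
    using assms by (simp add: field_simps)
  then have "ln (real N) \<le> ln (real h) + 1 / (2 * \<delta>) * ln (real h)"
    using N L \<open>0 < \<delta>\<close> \<open>1 \<le> d\<close> mult_mono[of "real h / (2 * d)" "1 / (2 * \<delta>)" "ln d" "ln (real h)"] by simp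
  then have "ln (real N) + ln (real h) + ln 2 \<le> (2 + 1 / (2 * \<delta>)) * ln (real h) + ln 2"
    by (simp add: distrib_right)
  moreover have "0 \<le> ln (real N)"
    using \<open>0 < N\<close> by simp
  ultimately have "real T * (ln (real N) + ln (real h) + ln 2) \<le> T' * ((2 + 1 / (2 * \<delta>)) * ln (real h) + ln 2)"
    using T L by (intro mult_mono) auto
  then have "real T * ln (real N) + real T * ln (real h) - (real h - real T) * ln 2
      \<le> T' * ((2 + 1 / (2 * \<delta>)) * ln (real h) + ln 2) - real h * ln 2"
    by (simp add: algebra_simps)
  moreover have "real N ^ T = exp (real T * ln (real N))" "real h ^ T = exp (real T * ln (real h))"
    using assms by (simp_all add: exp_of_nat_mult)
  moreover have "(1 / 2) ^ (h - T) = exp (- ((real h - real T) * ln 2))"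
    using \<open>T \<le> h\<close> exp_of_nat_mult[of "h - T" "- ln 2 :: real"] by (simp add: of_nat_diff exp_minus inverse_eq_divide)
  ultimately show ?thesis
    by (simp flip: exp_add)
qed

lemma heavy_pair_bound:
  fixes N T h s :: nat and \<epsilon> \<delta> d :: real
  assumes "0 < N" "0 < h" "0 < T" "0 < \<delta>" "\<delta> < 1" "0 < \<epsilon>" "\<epsilon> < 1" "\<delta> * real h \<le> d" "1 \<le> d" "2 * d \<le> real h"
    and N: "ln (real N) \<le> ln d + real h / (2 * d) * ln d"
    and s: "real s \<le> 2 * (1 - \<epsilon>) * d" and T: "d powr (1 - \<epsilon> / 4) \<le> real T"
    and d: "6 * d \<le> \<epsilon> / 4 * real h + 6" and h: "12 \<le> \<epsilon> * real h" "1 \<le> \<delta> * real h"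
  shows "real N ^ s * real h ^ s * (4 / real T) ^ (h - s)
    \<le> exp (ln (\<delta> * real h) * (6 - \<epsilon> / 2 * real h) + real h * (ln (1 / \<delta>) + ln 4))"
proof -
  let ?L = "ln d"
  have L: "0 \<le> ?L"
    using assms by simp
  have s2: "real s \<le> 2 * d" "s \<le> h"
  proof -
    have "2 * (1 - \<epsilon>) * d \<le> 2 * d"
      using assms by (intro mult_right_mono) auto
    with s show "real s \<le> 2 * d"
      by (rule order_trans)
    then show "s \<le> h"
      using assms by linarith
  qed
  have lnN: "real s * ln (real N) \<le> 2 * d * ?L + (1 - \<epsilon>) * real h * ?L"
  proof -
    have "real s * ln (real N) \<le> real s * (?L + real h / (2 * d) * ?L)"
      by (intro mult_left_mono N) simp
    also have "\<dots> \<le> (2 * (1 - \<epsilon>) * d) * (?L + real h / (2 * d) * ?L)"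
      using assms L by (intro mult_right_mono s) auto
    also have "\<dots> = 2 * d * ?L - \<epsilon> * (2 * d * ?L) + (1 - \<epsilon>) * real h * ?L"
      using assms by (simp add: field_simps)
    finally show ?thesis
      using assms L by (smt (verit) mult_nonneg_nonneg)
  qed
  have lnh: "real s * ln (real h) \<le> 2 * d * ?L + real h * ln (1 / \<delta>)"
  proof -
    have inv: "0 \<le> ln (1 / \<delta>)"
      using assms by simp
    have "real h \<le> d * (1 / \<delta>)"
      using assms by (simp add: field_simps)
    then have "ln (real h) \<le> ln (d * (1 / \<delta>))"
      using assms by (subst ln_le_cancel_iff) auto
    then have "ln (real h) \<le> ?L + ln (1 / \<delta>)"
      using assms by (subst (asm) ln_mult) auto
    then have "real s * ln (real h) \<le> 2 * d * (?L + ln (1 / \<delta>))"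
      using assms by (intro mult_mono s2) auto
    also have "\<dots> \<le> 2 * d * ?L + real h * ln (1 / \<delta>)"
      using assms inv by (simp add: distrib_left mult_right_mono del: ln_div)
    finally show ?thesis .
  qed
  have lnT: "(real h - real s) * (ln 4 - ln (real T)) \<le> real h * ln 4 - real h * (1 - \<epsilon> / 4) * ?L + 2 * d * ?L"
  proof -
    have "ln (d powr (1 - \<epsilon> / 4)) \<le> ln (real T)"
      using assms by (intro ln_mono) auto
    then have "(1 - \<epsilon> / 4) * ?L \<le> ln (real T)"
      using assms by (simp add: ln_powr)
    moreover have "(real h - 2 * d) * ((1 - \<epsilon> / 4) * ?L) \<le> (real h - real s) * ((1 - \<epsilon> / 4) * ?L)"
      using s2 assms L by (intro mult_right_mono) auto
    ultimately have "(real h - 2 * d) * ((1 - \<epsilon> / 4) * ?L) \<le> (real h - real s) * ln (real T)"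
      using s2 by (smt (verit) mult_left_mono of_nat_le_iff)
    moreover have "(real h - real s) * ln 4 \<le> real h * ln 4"
      by (intro mult_right_mono) auto
    moreover have "(real h - 2 * d) * ((1 - \<epsilon> / 4) * ?L) = real h * (1 - \<epsilon> / 4) * ?L - 2 * d * ?L + \<epsilon> / 4 * (2 * d * ?L)"
      by (simp add: field_simps)
    moreover have "0 \<le> \<epsilon> / 4 * (2 * d * ?L)"
      using assms L by simp
    ultimately show ?thesis
      by (simp only: right_diff_distrib)
  qed
  \<comment> \<open>Each of the three estimates contributes \<open>2 * d * ?L\<close>, hence
    \<open>6 * d\<close>; the main terms leave
    \<open>(1 - \<epsilon>) - (1 - \<epsilon> / 4)\<close>, that is,
    \<open>- 3 * \<epsilon> / 4\<close>.\<close>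
  have "real s * ln (real N) + real s * ln (real h) + (real h - real s) * (ln 4 - ln (real T))
      \<le> ?L * (6 * d - 3 * \<epsilon> / 4 * real h) + real h * (ln (1 / \<delta>) + ln 4)"
    using lnN lnh lnT by (simp add: algebra_simps del: ln_div)
  also have "\<dots> \<le> ?L * (6 - \<epsilon> / 2 * real h) + real h * (ln (1 / \<delta>) + ln 4)"
    using d L by (intro add_right_mono mult_left_mono) auto
  \<comment> \<open>By \<open>12 \<le> \<epsilon> * real h\<close> the factor is at most 0, so a
    lower bound for \<open>?L\<close> is what is needed here.\<close>
  also have "\<dots> \<le> ln (\<delta> * real h) * (6 - \<epsilon> / 2 * real h) + real h * (ln (1 / \<delta>) + ln 4)"
  proof -
    have "ln (\<delta> * real h) \<le> ?L"
      using assms by (intro ln_mono) auto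
    then show ?thesis
      using h by (intro add_right_mono mult_right_mono_neg) auto
  qed
  finally have exponent: "real s * ln (real N) + real s * ln (real h) + (real h - real s) * (ln 4 - ln (real T))
      \<le> ln (\<delta> * real h) * (6 - \<epsilon> / 2 * real h) + real h * (ln (1 / \<delta>) + ln 4)" .
  have "real N ^ s * real h ^ s * (4 / real T) ^ (h - s)
      = exp (real s * ln (real N) + real s * ln (real h) + (real h - real s) * (ln 4 - ln (real T)))"
  proof -
    have "real N ^ s = exp (real s * ln (real N))" "real h ^ s = exp (real s * ln (real h))"
      using assms by (simp_all add: exp_of_nat_mult)
    moreover have "(4 / real T) ^ (h - s) = exp ((real h - real s) * (ln 4 - ln (real T)))"
      using assms s2 exp_of_nat_mult[of "h - s" "ln 4 - ln (real T)"] by (simp add: of_nat_diff exp_diff)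
    ultimately show ?thesis
      by (simp add: exp_add)
  qed
  with exponent show ?thesis
    by simp
qed

lemma light_vector_limit:
  assumes "0 < \<epsilon>" "\<epsilon> < 1" "0 < \<delta>"
  shows "(\<lambda>h::nat. exp (2 * real h powr (1 - \<epsilon> / 4) * ((2 + 1 / (2 * \<delta>)) * ln (real h) + ln 2) - real h * ln 2)) \<longlonglongrightarrow> (0::real)"
proof -
  \<comment> \<open>With opaque constants, only \<open>0 < a\<close>, \<open>a < 1\<close> and
    \<open>0 < b\<close> matter: a power of \<open>h\<close> below 1 times \<open>ln h\<close> is
    negligible against \<open>h\<close>.\<close>
  define a b where "a = 1 - \<epsilon> / 4" and "b = 2 + 1 / (2 * \<delta>)"
  have "0 < a" "a < 1" "0 < b"
    using assms by (simp_all add: a_def b_def add_pos_pos)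
  then have "(\<lambda>h::nat. exp (2 * real h powr a * (b * ln (real h) + ln 2) - real h * ln 2)) \<longlonglongrightarrow> (0::real)"
    by real_asymp
  then show ?thesis
    by (simp add: a_def b_def)
qed

text \<open>The negative term of order \<open>h * ln h\<close> dominates the linear one, whatever
  \<open>C\<close> is.\<close>

lemma heavy_pair_limit:
  fixes C :: real
  assumes "0 < \<epsilon>" "0 < \<delta>"
  shows "(\<lambda>h::nat. exp (ln (\<delta> * real h) * (6 - \<epsilon> / 2 * real h) + real h * C)) \<longlonglongrightarrow> (0::real)"
  using assms by real_asymp

theorem theorem5p1:
  shows "\<exists>c2 :: real. c2 > 0 \<and>
    (\<forall>\<epsilon> \<delta> :: real. 0 < \<epsilon> \<and> \<epsilon> < 1 \<and> 0 < \<delta> \<and> \<delta> \<le> c2 * \<epsilon> \<longrightarrow>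
      ((\<lambda>h :: nat.
          let d = nat \<lceil>\<delta> * real h\<rceil>; N = bigN h d in
          real (card {M \<in> pm_matrices h N.
                        ereal (2 * (1 - \<epsilon>) * real d) \<le> d2 (matrix_kernel h N M)})
          / real (card (pm_matrices h N)))
       \<longlongrightarrow> 1) sequentially)"
proof (intro exI[of _ "1 / 24"] conjI allI impI)
  fix \<epsilon> \<delta> :: real
  assume asm: "0 < \<epsilon> \<and> \<epsilon> < 1 \<and> 0 < \<delta> \<and> \<delta> \<le> 1 / 24 * \<epsilon>"
  define d where "d h = nat \<lceil>\<delta> * real h\<rceil>" for h :: nat
  define N where "N h = bigN h (d h)" for h
  define P where "P h = real (card {M \<in> pm_matrices h (N h).
      ereal (2 * (1 - \<epsilon>) * real (d h)) \<le> d2 (matrix_kernel h (N h) M)}) / real (card (pm_matrices h (N h)))" for h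
  define f where "f h = exp (2 * real h powr (1 - \<epsilon> / 4) * ((2 + 1 / (2 * \<delta>)) * ln (real h) + ln 2) - real h * ln 2)
      + exp (ln (\<delta> * real h) * (6 - \<epsilon> / 2 * real h) + real h * (ln (1 / \<delta>) + ln 4))" for h :: nat
  have "f \<longlonglongrightarrow> 0 + 0"
    unfolding f_def using asm by (intro tendsto_add light_vector_limit heavy_pair_limit) auto
  then have lim: "(\<lambda>h. 1 - f h) \<longlonglongrightarrow> 1"
    using tendsto_diff[OF tendsto_const[of 1]] by fastforce
  have lower: "1 - f h \<le> P h" if h: "12 / \<epsilon> \<le> real h" "4 / \<delta> \<le> real h" for h
  proof -
    have h\<epsilon>: "12 \<le> \<epsilon> * real h" and h\<delta>: "4 \<le> \<delta> * real h"
      using h asm by (simp_all add: field_simps)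
    have "0 < real h"
      using h\<delta> asm by (cases "h = 0") auto
    have d_lower: "\<delta> * real h \<le> real (d h)"
      by (simp add: d_def real_nat_ceiling_ge)
    have d_upper: "real (d h) \<le> \<delta> * real h + 1"
      using h\<delta> unfolding d_def by linarith
    \<comment> \<open>The constant \<open>1 / 24\<close> enters here:
      \<open>6 * d h \<le> 6 * \<delta> * real h + 6\<close>, and
      \<open>6 / 24 = 1 / 4\<close>.\<close>
    have "\<delta> * real h \<le> \<epsilon> / 24 * real h"
      using asm by (intro mult_right_mono) auto
    then have d6: "6 * real (d h) \<le> \<epsilon> / 4 * real h + 6"
      using d_upper by simp
    have d4: "4 \<le> d h"
      using h\<delta> d_lower by linarith
    have "\<epsilon> * real h \<le> 1 * real h"
      using asm by (intro mult_right_mono) auto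
    then have d2h: "2 * real (d h) \<le> real h"
      using d6 h\<epsilon> by linarith
    then have d2h': "2 * d h \<le> h"
      by linarith
    \<comment> \<open>\<open>T\<close> is rounded up to keep the lower bound that the pair estimate
      needs; as \<open>h powr (1 - \<epsilon> / 4) \<ge> 1\<close>, this costs at most a factor 2.
      \<open>s\<close> is rounded down and still bounds every integer below the threshold.\<close>
    define T where "T = nat \<lceil>real (d h) powr (1 - \<epsilon> / 4)\<rceil>"
    define s where "s = nat \<lfloor>2 * (1 - \<epsilon>) * real (d h)\<rfloor>"
    have N_ge: "2 * d h \<le> N h"
      unfolding N_def using d2h' d4 by (rule bigN_ge)
    have lnN: "ln (real (N h)) \<le> ln (real (d h)) + real h / (2 * real (d h)) * ln (real (d h))"
      unfolding N_def using d2h' d4 by (rule ln_bigN_le)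
    have T_ge: "real (d h) powr (1 - \<epsilon> / 4) \<le> real T"
      by (simp add: T_def real_nat_ceiling_ge)
    have "0 < real (d h) powr (1 - \<epsilon> / 4)"
      using d4 by simp
    then have "0 < T"
      using T_ge by linarith
    have "real (d h) powr (1 - \<epsilon> / 4) \<le> real (d h) powr 1"
      using asm d4 by (intro powr_mono) auto
    then have "T \<le> d h"
      unfolding T_def using d4 by (simp add: nat_le_iff ceiling_le_iff)
    have "real (d h) powr (1 - \<epsilon> / 4) \<le> real h powr (1 - \<epsilon> / 4)"
      using asm d2h by (intro powr_mono2) auto
    moreover have "1 \<le> real h powr (1 - \<epsilon> / 4)"
      using asm \<open>0 < real h\<close> by (intro ge_one_powr_ge_zero) auto
    moreover have "real T \<le> real (d h) powr (1 - \<epsilon> / 4) + 1"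
      using \<open>0 < real (d h) powr (1 - \<epsilon> / 4)\<close> unfolding T_def by linarith
    ultimately have T_le: "real T \<le> 2 * real h powr (1 - \<epsilon> / 4)"
      by linarith
    have x0: "0 \<le> 2 * (1 - \<epsilon>) * real (d h)"
      using asm by simp
    then have s_le: "real s \<le> 2 * (1 - \<epsilon>) * real (d h)"
      unfolding s_def by linarith
    have "2 * (1 - \<epsilon>) * real (d h) \<le> 2 * real (d h)"
      using asm by (intro mult_right_mono) auto
    then have "s \<le> 2 * d h"
      using s_le by linarith
    have "1 - (real (N h) ^ T * real h ^ T * (1 / 2) ^ (h - T) + real (N h) ^ s * real h ^ s * (4 / real T) ^ (h - s)) \<le> P h"
      unfolding P_def
    proof (rule prob_d2_ge)
      show "n \<le> s" if "real n < 2 * (1 - \<epsilon>) * real (d h)" for n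
        using that unfolding s_def by linarith
    qed (use \<open>0 < T\<close> \<open>T \<le> d h\<close> \<open>s \<le> 2 * d h\<close> N_ge d2h' in auto)
    moreover have "real (N h) ^ T * real h ^ T * (1 / 2) ^ (h - T)
        \<le> exp (2 * real h powr (1 - \<epsilon> / 4) * ((2 + 1 / (2 * \<delta>)) * ln (real h) + ln 2) - real h * ln 2)"
      by (rule light_vector_bound[OF _ _ _ _ d_lower _ _ lnN T_le])
        (use asm N_ge d4 d2h \<open>T \<le> d h\<close> \<open>0 < real h\<close> in auto)
    moreover have "real (N h) ^ s * real h ^ s * (4 / real T) ^ (h - s)
        \<le> exp (ln (\<delta> * real h) * (6 - \<epsilon> / 2 * real h) + real h * (ln (1 / \<delta>) + ln 4))"
      by (rule heavy_pair_bound[OF _ _ _ _ _ _ _ d_lower _ d2h lnN s_le T_ge d6 h\<epsilon>])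
        (use asm N_ge d4 \<open>0 < T\<close> \<open>0 < real h\<close> h\<delta> in auto)
    ultimately show ?thesis
      unfolding f_def by linarith
  qed
  have upper: "P h \<le> 1" for h
  proof -
    have "card {M \<in> pm_matrices h (N h). ereal (2 * (1 - \<epsilon>) * real (d h)) \<le> d2 (matrix_kernel h (N h) M)}
        \<le> card (pm_matrices h (N h))"
      by (rule card_mono) (auto simp: finite_pm_matrices)
    moreover have pos: "0 < real (card (pm_matrices h (N h)))"
      unfolding card_pm_matrices by simp
    ultimately show ?thesis
      unfolding P_def divide_le_eq_1_pos[OF pos] by (simp only: of_nat_le_iff)
  qed
  have "P \<longlonglongrightarrow> 1"
  proof (rule tendsto_sandwich[OF _ _ lim tendsto_const])
    show "\<forall>\<^sub>F h in sequentially. 1 - f h \<le> P h"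
      using eventually_ge_at_top[of "nat \<lceil>12 / \<epsilon>\<rceil>"] eventually_ge_at_top[of "nat \<lceil>4 / \<delta>\<rceil>"]
      by eventually_elim (rule lower; linarith)
  qed (simp add: upper)
  then show "((\<lambda>h :: nat.
          let d = nat \<lceil>\<delta> * real h\<rceil>; N = bigN h d in
          real (card {M \<in> pm_matrices h N.
                        ereal (2 * (1 - \<epsilon>) * real d) \<le> d2 (matrix_kernel h N M)})
          / real (card (pm_matrices h N)))
       \<longlongrightarrow> 1) sequentially"
    unfolding P_def N_def d_def Let_def .
qed simp

end
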